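(* Let $(L,\wedge,\vee,0,1,\otimes,e)$ be an integral lattice-ordered monoid (so $e=1$), let $\Sigma$ be a finite non-empty alphabet, and let $r$ be a fuzzy regular expression over $\Sigma$ with scalars in $L$, with associated fuzzy language $\|r\|:\Sigma^*\to L$. Let $r_R$ be the ordinary regular expression over $\Sigma\cup Y$ obtained from $r$ by replacing the scalars occurring in $r$ by letters from $Y$, and let $A_{fA}(r)$ be the fuzzy automaton over $\Sigma$ obtained from the follow automaton $A_f(r_R)$ as described in the context. Then $$L(A_{fA}(r))=\|r\|,$$ that is, $L(A_{fA}(r))(u)=\|r\|(u)$ for every $u\in\Sigma^*$.
   Context: **Lattice-ordered monoids.** A lattice-ordered monoid is a structure $(L,\wedge,\vee,0,1,\otimes,e)$ such that $(L,\wedge,\vee)$ is a lattice with least element $0$ and greatest element $1$, $(L,\otimes,e)$ is a monoid with identity $e$ (not assumed commutative), $u\otimes 0=0\otimes u=0$ for all $u\in L$, and $u\otimes(v\vee w)=(u\otimes v)\vee(u\otimes w)$, $(u\vee v)\otimes w=(u\otimes w)\vee(v\otimes w)$ for all $u,v,w\in L$. It is integral if $e=1$. The empty join is $0$. **Fuzzy automata.** A fuzzy automaton over $L$ is a tuple $A=(Q,\Sigma,\delta,\sigma,\tau)$ with $Q$ a finite non-empty set of states, $\Sigma$ a finite non-empty alphabet, $\delta:Q\times\Sigma\times Q\to L$, and $\sigma,\tau:Q\to L$ (fuzzy sets of initial and final states). Extend $\delta$ to $\delta_*:Q\times\Sigma^*\times Q\to L$ by $\delta_*(p,\varepsilon,q)=1$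 if $p=q$ and $0$ otherwise, and $\delta_*(p,ua,q)=\bigvee_{s\in Q}\delta_*(p,u,s)\otimes\delta(s,a,q)$ for $u\in\Sigma^*$, $a\in\Sigma$. The fuzzy language of $A$ is $L(A)(u)=\bigvee_{p,q\in Q}\sigma(p)\otimes\delta_*(p,u,q)\otimes\tau(q)$ for $u\in\Sigma^*$. **Fuzzy regular expressions.** These are defined inductively: $\emptyset$, $\varepsilon$ and each $a\in\Sigma$ are fuzzy regular expressions; if $r,r_1,r_2$ are fuzzy regular expressions and $\lambda\in L$, then so are $(\lambda r)$, $(r_1+r_2)$, $(r_1r_2)$ and $r^*$. The fuzzy language $\|r\|:\Sigma^*\to L$ is defined by: $\|\emptyset\|(u)=0$ for all $u$; for $x\in\Sigma\cup\{\varepsilon\}$, $\|x\|(u)=1$ if $u=x$ and $0$ otherwise; $\|\lambda r\|(u)=\lambda\otimes\|r\|(u)$; $\|r_1+r_2\|=\|r_1\|\vee\|r_2\|$ (pointwise); $\|r_1r_2\|=\|r_1\|\,\|r_2\|$; $\|r^*\|=\|r\|^*$. Here, for $f,g:\Sigma^*\to L$, $(fg)(u)=\bigvee_{u=vw}f(v)\otimes g(w)$, and $f^*(u)=\bigvee_{n\ge 0}f^n(u)$, where $f^0$ is the characteristic function of $\{\varepsilon\}$ and $f^{n+1}=f^nf$ (this supremum exists because $L$ is integral). **Associated ordinary regular expression.** Given $r$, let $Y$ be a finite alphabet, disjoint from $\Sigma$, in bijection with the set of scalars occurring in $r$. Let $r_R$ be the ordinary regular expression over $\Sigma\cup Y$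 obtained from $r$ by replacing each occurrence of a scalar by the corresponding letter of $Y$, scalar multiplication becoming concatenation. Let $\varphi_r:\Sigma\cup Y\to L$ send each $a\in\Sigma$ to $1$ and each letter of $Y$ to the scalar it represents, and let $\varphi_r^*:(\Sigma\cup Y)^*\to(L,\otimes,1)$ be the monoid homomorphism extending $\varphi_r$. **Follow automaton.** Let $n$ be the number of occurrences of letters of $\Sigma\cup Y$ in $r_R$, and mark these occurrences by distinct positions $1,\dots,n$, giving a marked regular expression whose letters are all distinct; identify its letters with positions, and let $\mathcal L'\subseteq\{1,\dots,n\}^*$ be its language. Let $\mathrm{follow}(0)$ be the set of positions that begin some word of $\mathcal L'$; for $i\ge1$ let $\mathrm{follow}(i)$ be the set of positions $j$ such that $ij$ occurs as two consecutive letters in some word of $\mathcal L'$; let $\mathrm{last}$ be the set of positions that end some word of $\mathcal L'$, together with $0$ if $\varepsilon\in\mathcal L'$. The position automaton has states $\{0,1,\dots,n\}$, initial state $0$, set of final states $\mathrm{last}$, and a transition from $i$ to $j$ labelled by the letter of $\Sigma\cup Y$ at position $j$ whenever $j\in\mathrm{follow}(i)$. Define $i\equiv_f j$ iff ($i,j$ both belong to $\mathrm{last}$ or neither does) and $\mathrm{follow}(i)=\mathrm{follow}(j)$. The follow automaton $A_f(r_R)$ is the quotient of the position automaton by $\equiv_f$: its states are the $\equiv_f$-classes, its initial state is the class of $0$, a class is final iff its elements lie in $\mathrm{last}$, and there is a transition labelled $x$ from class $C$ to class $D$ iff the position automaton has a transition labelled $x$ from some element of $C$ to some element of $D$. **The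 fuzzy automaton $A_{fA}(r)$.** Let $Q_f$ be the set of states of $A_f(r_R)$. For words $u,v\in(\Sigma\cup Y)^*$ write $u\le_{em}v$ if $u$ is a (scattered) subword of $v$. For $i,j\in Q_f$ and $a\in\Sigma$, let $P(i,a,j)$ be the set of words $u\in U_Y(a):=Y^*aY^*$ that label a path from $i$ to $j$ in $A_f(r_R)$, and let $M(i,a,j)$ be the (finite) set of $\le_{em}$-minimal elements of $P(i,a,j)$. Let $M(i,\varepsilon)$ be the (finite) set of $\le_{em}$-minimal elements of the set of words $u\in Y^*$ labelling a path in $A_f(r_R)$ from $i$ to some final state. Then $A_{fA}(r)=(Q_f,\Sigma,\delta,\sigma,\tau)$, where $$\delta(i,a,j)=\bigvee_{u\in M(i,a,j)}\varphi_r^*(u),\qquad \tau(i)=\bigvee_{u\in M(i,\varepsilon)}\varphi_r^*(u),$$ and $\sigma(i)=1$ if $i$ is the initial state of $A_f(r_R)$ and $\sigma(i)=0$ otherwise. *)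

theory Defs
  imports "HOL-Library.Lub_Glb" "HOL-Library.Sublist"
begin

section \<open>Lattice-ordered monoids\<close>

text \<open>The usual \<open>0\<close>, \<open>1\<close>, \<open>\<otimes>\<close> and \<open>e\<close> are \<open>bot\<close>, \<open>top\<close>, \<open>(*)\<close> and \<open>1\<close>.\<close>

class lattice_ordered_monoid = bounded_lattice + monoid_mult +
  assumes mult_bot_right: "u * bot = bot"
    and mult_bot_left: "bot * u = bot"
    and mult_sup_distrib_left: "u * sup v w = sup (u * v) (u * w)"
    and mult_sup_distrib_right: "sup u v * w = sup (u * w) (v * w)"

class integral_lattice_ordered_monoid = lattice_ordered_monoid +
  assumes one_eq_top: "1 = top"

text \<open>
  \<open>L\<close> is not assumed to be complete, so a join is the least upper bound whenever there is one;
  see \<open>join_finite\<close>, \<open>fstar_isLub\<close> and \<open>finite_fuzzy_follow_automaton\<close> for the existence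
  of the joins used below.
\<close>

definition join :: "'l::lattice_ordered_monoid set \<Rightarrow> 'l" where
  "join S = (THE s. isLub UNIV S s)"


section \<open>Fuzzy automata\<close>

text \<open>The alphabet of an automaton is the whole type \<open>'a\<close>, which is instantiated by a finite type.\<close>

record ('q, 'a, 'l) fuzzy_automaton =
  fstates :: "'q set"
  ftrans :: "'q \<Rightarrow> 'a \<Rightarrow> 'q \<Rightarrow> 'l"
  finitial :: "'q \<Rightarrow> 'l"
  ffinal :: "'q \<Rightarrow> 'l"

function ftrans_star ::
  "('q, 'a, 'l::lattice_ordered_monoid) fuzzy_automaton \<Rightarrow> 'q \<Rightarrow> 'a list \<Rightarrow> 'q \<Rightarrow> 'l" where
  "ftrans_star A p [] q = (if p = q then top else bot)"
| "ftrans_star A p (u @ [a]) q = join {ftrans_star A p u s * ftrans A s a q | s. s \<in> fstates A}"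
  by (metis prod_cases4 rev_exhaust) auto
termination by (relation "measure (\<lambda>(A, p, u, q). length u)") auto

definition automaton_language ::
  "('q, 'a, 'l::lattice_ordered_monoid) fuzzy_automaton \<Rightarrow> 'a list \<Rightarrow> 'l" where
  "automaton_language A u =
     join {finitial A p * ftrans_star A p u q * ffinal A q | p q. p \<in> fstates A \<and> q \<in> fstates A}"


section \<open>Fuzzy regular expressions\<close>

text \<open>The set function \<open>scalars\<close> generated here yields the scalars occurring in an expression.\<close>

datatype (letters: 'a, scalars: 'l) fuzzy_regex =
    FEmpty
  | FEps
  | FLetter 'a
  | FScalar 'l "('a, 'l) fuzzy_regex"
  | FPlus "('a, 'l) fuzzy_regex" "('a, 'l) fuzzy_regex"
  | FTimes "('a, 'l) fuzzy_regex" "('a, 'l) fuzzy_regex"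
  | FStar "('a, 'l) fuzzy_regex"

definition fchar :: "'a list \<Rightarrow> 'a list \<Rightarrow> 'l::lattice_ordered_monoid" where
  "fchar x u = (if u = x then top else bot)"

definition fconc ::
  "('a list \<Rightarrow> 'l::lattice_ordered_monoid) \<Rightarrow> ('a list \<Rightarrow> 'l) \<Rightarrow> 'a list \<Rightarrow> 'l" where
  "fconc f g u = join {f v * g w | v w. u = v @ w}"

primrec fpow :: "('a list \<Rightarrow> 'l::lattice_ordered_monoid) \<Rightarrow> nat \<Rightarrow> 'a list \<Rightarrow> 'l" where
  "fpow f 0 = fchar []"
| "fpow f (Suc n) = fconc (fpow f n) f"

definition fstar :: "('a list \<Rightarrow> 'l::lattice_ordered_monoid) \<Rightarrow> 'a list \<Rightarrow> 'l" where
  "fstar f u = join (range (\<lambda>n. fpow f n u))"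

primrec regex_language :: "('a, 'l::lattice_ordered_monoid) fuzzy_regex \<Rightarrow> 'a list \<Rightarrow> 'l" where
  "regex_language FEmpty = (\<lambda>u. bot)"
| "regex_language FEps = fchar []"
| "regex_language (FLetter a) = fchar [a]"
| "regex_language (FScalar l r) = (\<lambda>u. l * regex_language r u)"
| "regex_language (FPlus r s) = (\<lambda>u. sup (regex_language r u) (regex_language s u))"
| "regex_language (FTimes r s) = fconc (regex_language r) (regex_language s)"
| "regex_language (FStar r) = fstar (regex_language r)"


section \<open>The associated ordinary regular expression\<close>

datatype 'c regex =
    Empty
  | Eps
  | Letter 'c
  | Plus "'c regex" "'c regex"
  | Times "'c regex" "'c regex"
  | Star "'c regex"

primrec lang :: "'c regex \<Rightarrow> 'c list set" where
  "lang Empty = {}"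
| "lang Eps = {[]}"
| "lang (Letter c) = {[c]}"
| "lang (Plus r s) = lang r \<union> lang s"
| "lang (Times r s) = {v @ w | v w. v \<in> lang r \<and> w \<in> lang s}"
| "lang (Star r) = concat ` lists (lang r)"

primrec ordinary :: "('l \<Rightarrow> 'y) \<Rightarrow> ('a, 'l) fuzzy_regex \<Rightarrow> ('a + 'y) regex" where
  "ordinary c FEmpty = Empty"
| "ordinary c FEps = Eps"
| "ordinary c (FLetter a) = Letter (Inl a)"
| "ordinary c (FScalar l r) = Times (Letter (Inr (c l))) (ordinary c r)"
| "ordinary c (FPlus r s) = Plus (ordinary c r) (ordinary c s)"
| "ordinary c (FTimes r s) = Times (ordinary c r) (ordinary c s)"
| "ordinary c (FStar r) = Star (ordinary c r)"

text \<open>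
  Here \<open>\<Sigma> \<union> Y\<close> is rendered as a disjoint sum, and \<open>val\<close> maps each letter in \<open>Y\<close> to the scalar it
  represents; it is meant to be a bijection from \<open>Y\<close> onto \<open>scalars r\<close>.
\<close>

definition ordinary_regex :: "'y set \<Rightarrow> ('y \<Rightarrow> 'l) \<Rightarrow> ('a, 'l) fuzzy_regex \<Rightarrow> ('a + 'y) regex" where
  "ordinary_regex Y val r = ordinary (inv_into Y val) r"

definition letter_value :: "('y \<Rightarrow> 'l::lattice_ordered_monoid) \<Rightarrow> 'a + 'y \<Rightarrow> 'l" where
  "letter_value val = case_sum (\<lambda>a. top) val"

definition word_value :: "('y \<Rightarrow> 'l::lattice_ordered_monoid) \<Rightarrow> ('a + 'y) list \<Rightarrow> 'l" where
  "word_value val w = prod_list (map (letter_value val) w)"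


section \<open>Position automaton and follow automaton\<close>

primrec occurrences :: "'c regex \<Rightarrow> 'c list" where
  "occurrences Empty = []"
| "occurrences Eps = []"
| "occurrences (Letter c) = [c]"
| "occurrences (Plus r s) = occurrences r @ occurrences s"
| "occurrences (Times r s) = occurrences r @ occurrences s"
| "occurrences (Star r) = occurrences r"

text \<open>\<open>mark k r\<close> numbers the letter occurrences of \<open>r\<close> from left to right by \<open>k + 1, k + 2, \<dots>\<close>.\<close>

primrec mark :: "nat \<Rightarrow> 'c regex \<Rightarrow> nat regex" where
  "mark k Empty = Empty"
| "mark k Eps = Eps"
| "mark k (Letter c) = Letter (Suc k)"
| "mark k (Plus r s) = Plus (mark k r) (mark (k + length (occurrences r)) s)"
| "mark k (Times r s) = Times (mark k r) (mark (k + length (occurrences r)) s)"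
| "mark k (Star r) = Star (mark k r)"

definition marked_lang :: "'c regex \<Rightarrow> nat list set" where
  "marked_lang r = lang (mark 0 r)"

definition letter_at :: "'c regex \<Rightarrow> nat \<Rightarrow> 'c" where
  "letter_at r j = occurrences r ! (j - 1)"

definition follow :: "'c regex \<Rightarrow> nat \<Rightarrow> nat set" where
  "follow r i =
     (if i = 0 then {j. \<exists>w. j # w \<in> marked_lang r}
      else {j. \<exists>v w. v @ [i, j] @ w \<in> marked_lang r})"

definition last_pos :: "'c regex \<Rightarrow> nat set" where
  "last_pos r = {i. \<exists>v. v @ [i] \<in> marked_lang r} \<union> (if [] \<in> marked_lang r then {0} else {})"

record ('q, 'c) nfa =
  states :: "'q set"
  initial :: 'q
  final :: "'q set"
  transitions :: "('q \<times> 'c \<times> 'q) set"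

primrec nfa_path :: "('q, 'c) nfa \<Rightarrow> 'q \<Rightarrow> 'c list \<Rightarrow> 'q \<Rightarrow> bool" where
  "nfa_path A p [] q \<longleftrightarrow> p = q"
| "nfa_path A p (c # w) q \<longleftrightarrow> (\<exists>s. (p, c, s) \<in> transitions A \<and> nfa_path A s w q)"

definition position_automaton :: "'c regex \<Rightarrow> (nat, 'c) nfa" where
  "position_automaton r =
     \<lparr>states = {0..length (occurrences r)}, initial = 0, final = last_pos r,
      transitions = {(i, letter_at r j, j) | i j. i \<in> {0..length (occurrences r)} \<and> j \<in> follow r i}\<rparr>"

definition follow_equiv :: "'c regex \<Rightarrow> (nat \<times> nat) set" where
  "follow_equiv r =
     {(i, j). i \<in> states (position_automaton r) \<and> j \<in> states (position_automaton r) \<and>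
        (i \<in> last_pos r \<longleftrightarrow> j \<in> last_pos r) \<and> follow r i = follow r j}"

definition nfa_quotient :: "('q, 'c) nfa \<Rightarrow> ('q \<times> 'q) set \<Rightarrow> ('q set, 'c) nfa" where
  "nfa_quotient A E =
     \<lparr>states = states A // E, initial = E `` {initial A}, final = {C \<in> states A // E. C \<subseteq> final A},
      transitions = {(C, x, D). C \<in> states A // E \<and> D \<in> states A // E \<and>
                 (\<exists>i\<in>C. \<exists>j\<in>D. (i, x, j) \<in> transitions A)}\<rparr>"

definition follow_automaton :: "'c regex \<Rightarrow> (nat set, 'c) nfa" where
  "follow_automaton r = nfa_quotient (position_automaton r) (follow_equiv r)"


section \<open>The fuzzy automaton obtained from the follow automaton\<close>

definition minimal_words :: "'c list set \<Rightarrow> 'c list set" where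
  "minimal_words P = {u \<in> P. \<forall>v\<in>P. subseq v u \<longrightarrow> v = u}"

definition letter_words :: "'y set \<Rightarrow> 'a \<Rightarrow> ('a + 'y) list set" where
  "letter_words Y a = {v @ [Inl a] @ w | v w. v \<in> lists (Inr ` Y) \<and> w \<in> lists (Inr ` Y)}"

definition minimal_trans ::
  "('q, 'a + 'y) nfa \<Rightarrow> 'y set \<Rightarrow> 'q \<Rightarrow> 'a \<Rightarrow> 'q \<Rightarrow> ('a + 'y) list set" where
  "minimal_trans A Y i a j = minimal_words {u \<in> letter_words Y a. nfa_path A i u j}"

definition minimal_final :: "('q, 'a + 'y) nfa \<Rightarrow> 'y set \<Rightarrow> 'q \<Rightarrow> ('a + 'y) list set" where
  "minimal_final A Y i = minimal_words {u \<in> lists (Inr ` Y). \<exists>f\<in>final A. nfa_path A i u f}"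

definition fuzzy_follow_automaton ::
  "'y set \<Rightarrow> ('y \<Rightarrow> 'l::lattice_ordered_monoid) \<Rightarrow> ('a, 'l) fuzzy_regex
    \<Rightarrow> (nat set, 'a, 'l) fuzzy_automaton" where
  "fuzzy_follow_automaton Y val r =
     (let A = follow_automaton (ordinary_regex Y val r) in
      \<lparr>fstates = states A,
       ftrans = (\<lambda>i a j. join (word_value val ` minimal_trans A Y i a j)),
       finitial = (\<lambda>i. if i = initial A then top else bot),
       ffinal = (\<lambda>i. join (word_value val ` minimal_final A Y i))\<rparr>)"


section \<open>Existence of the joins\<close>

lemma join_eqI: "isLub UNIV S s \<Longrightarrow> join S = s"
  unfolding join_def by (rule the_equality) (auto simp: isLub_def leastP_def isUb_def setle_def setge_def intro: order.antisym)

lemma isLub_finite: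
  fixes S :: "'l::lattice_ordered_monoid set"
  assumes "finite S"
  shows "isLub UNIV S (Sup_fin (insert bot S))"
  using assms
  by (auto simp: isLub_def leastP_def isUb_def setle_def setge_def intro: Sup_fin.coboundedI Sup_fin.boundedI)

lemma join_finite: "finite S \<Longrightarrow> join S = Sup_fin (insert bot S)"
  by (intro join_eqI isLub_finite)

lemma join_empty: "join {} = bot"
  by (simp add: join_finite)

lemma lom_mult_left_mono:
  fixes a b c :: "'l::lattice_ordered_monoid"
  assumes "a \<le> b" shows "c * a \<le> c * b"
  using mult_sup_distrib_left[of c a b] assms by (metis sup.absorb_iff2)

lemma lom_mult_right_mono:
  fixes a b c :: "'l::lattice_ordered_monoid"
  assumes "a \<le> b" shows "a * c \<le> b * c"
  using mult_sup_distrib_right[of a b c] assms by (metis sup.absorb_iff2)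

lemma Sup_fin_mult_le:
  fixes c d :: "'l::lattice_ordered_monoid"
  assumes "finite S" and "\<And>s. s \<in> S \<Longrightarrow> s * c \<le> d"
  shows "Sup_fin (insert bot S) * c \<le> d"
  using assms
proof (induction S rule: finite_induct)
  case empty
  then show ?case by (simp add: mult_bot_left)
next
  case (insert x S)
  have "Sup_fin (insert bot (insert x S)) = sup x (Sup_fin (insert bot S))"
    using insert.hyps by (simp add: insert_commute[of bot x])
  then show ?case using insert by (simp add: mult_sup_distrib_right)
qed

lemma finite_splits: "finite {(v, w). u = v @ w}"
proof (rule finite_subset)
  show "{(v, w). u = v @ w} \<subseteq> (\<lambda>k. (take k u, drop k u)) ` {..length u}"
  proof clarify
    fix v w assume "u = v @ w"
    then show "(v, w) \<in> (\<lambda>k. (take k (v @ w), drop k (v @ w))) ` {..length (v @ w)}"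
      by (intro image_eqI[of _ _ "length v"]) auto
  qed
qed simp

lemma finite_split_products: "finite {f v * g w | v w. u = v @ w}"
proof -
  have "{f v * g w | v w. u = v @ w} = (\<lambda>(v, w). f v * g w) ` {(v, w). u = v @ w}" by auto
  then show ?thesis using finite_splits[of u] by simp
qed

lemma fpow_bounded:
  fixes f :: "'a list \<Rightarrow> 'l::integral_lattice_ordered_monoid"
  shows "fpow f n u \<le> Sup_fin (insert bot ((\<lambda>m. fpow f m u) ` {..length u}))"
proof (induction n arbitrary: u)
  case 0
  have "fpow f 0 u \<in> (\<lambda>m. fpow f m u) ` {..length u}" by (rule imageI) simp
  then show ?case by (intro Sup_fin.coboundedI) auto
next
  case (Suc n)
  let ?B = "\<lambda>u. Sup_fin (insert bot ((\<lambda>m. fpow f m u) ` {..length u}))"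
  have fconc_le: "fpow f m v * f w \<le> fpow f (Suc m) (v @ w)" for m v w
    by (auto simp: fconc_def join_finite[OF finite_split_products]
        intro!: Sup_fin.coboundedI finite_split_products)
  have "fpow f n v * f w \<le> ?B (v @ w)" for v w
  proof (cases "w = []")
    case True
    have "fpow f n v * f w \<le> fpow f n v * 1"
      by (rule lom_mult_left_mono) (simp add: one_eq_top)
    then show ?thesis using Suc.IH[of v] True by (auto intro: order.trans)
  next
    case False
    have "?B v * f w \<le> ?B (v @ w)"
    proof (rule Sup_fin_mult_le)
      fix s assume "s \<in> (\<lambda>m. fpow f m v) ` {..length v}"
      then obtain m where m: "m \<le> length v" "s = fpow f m v" by auto
      have "fpow f (Suc m) (v @ w) \<le> ?B (v @ w)"
      proof (rule Sup_fin.coboundedI)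
        have "Suc m \<le> length (v @ w)" using m False by (cases w) auto
        then show "fpow f (Suc m) (v @ w)
            \<in> insert bot ((\<lambda>m. fpow f m (v @ w)) ` {..length (v @ w)})"
          by blast
      qed simp
      then show "s * f w \<le> ?B (v @ w)" using fconc_le[of m v w] m by (auto intro: order.trans)
    qed simp
    then show ?thesis using lom_mult_right_mono[OF Suc.IH[of v], of "f w"] by (rule order.trans[rotated])
  qed
  then show ?case
    by (auto simp: fconc_def join_finite[OF finite_split_products]
        intro!: Sup_fin.boundedI finite_split_products)
qed

lemma fstar_isLub:
  fixes f :: "'a list \<Rightarrow> 'l::integral_lattice_ordered_monoid"
  shows "isLub UNIV (range (\<lambda>n. fpow f n u)) (fstar f u)"
proof -
  let ?b = "Sup_fin (insert bot ((\<lambda>m. fpow f m u) ` {..length u}))"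
  have "isLub UNIV (range (\<lambda>n. fpow f n u)) ?b"
    using fpow_bounded[of f _ u]
    by (auto simp: isLub_def leastP_def isUb_def setle_def setge_def intro!: Sup_fin.boundedI)
  then show ?thesis unfolding fstar_def by (simp add: join_eqI)
qed

lemma nfa_path_append: "nfa_path A p (v @ w) q \<longleftrightarrow> (\<exists>s. nfa_path A p v s \<and> nfa_path A s w q)"
  by (induction v arbitrary: p) auto

lemma nfa_path_short_subseq:
  assumes fin: "finite (states A)"
    and closed: "\<forall>(p, c, s)\<in>transitions A. s \<in> states A"
    and "nfa_path A p v q" "p \<in> states A"
  shows "\<exists>v'. subseq v' v \<and> nfa_path A p v' q \<and> length v' \<le> card (states A)"
  using assms(3)
proof (induction "length v" arbitrary: v rule: less_induct)
  case less
  have mem: "nfa_path A p v s \<Longrightarrow> s \<in> states A" for v s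
    using \<open>p \<in> states A\<close> closed by (induction v arbitrary: p) auto
  show ?case
  proof (cases "length v \<le> card (states A)")
    case True
    then show ?thesis using less.prems by blast
  next
    case False
    have "\<exists>s. nfa_path A p (take k v) s \<and> nfa_path A s (drop k v) q" for k
      using less.prems nfa_path_append[of A p "take k v" "drop k v" q] by simp
    then obtain f where f: "\<And>k. nfa_path A p (take k v) (f k) \<and> nfa_path A (f k) (drop k v) q" by metis
    have "card (f ` {..length v}) \<le> card (states A)"
      using f mem by (intro card_mono fin) blast
    then have "\<not> inj_on f {..length v}" using False pigeonhole[of f "{..length v}"] by simp
    then obtain k l where kl: "k < l" "l \<le> length v" "f k = f l"
      unfolding inj_on_def by (metis atMost_iff linorder_neqE_nat)
    let ?w = "take k v @ drop l v"
    have "nfa_path A p ?w q" using f[of k] f[of l] kl by (auto simp: nfa_path_append)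
    moreover have "length ?w < length v" using kl by simp
    ultimately obtain v' where v': "subseq v' ?w" "nfa_path A p v' q" "length v' \<le> card (states A)"
      using less.hyps by blast
    have "subseq (drop l v) (drop k v)"
      using kl by (metis less_imp_le_nat suffix_drop suffix_imp_subseq drop_drop le_add_diff_inverse2)
    then have "subseq ?w v"
      by (metis append_take_drop_id list_emb_append_mono subseq_order.order_refl)
    with v' show ?thesis by (meson subseq_order.order_trans)
  qed
qed

lemma subseq_lists: "subseq v w \<Longrightarrow> w \<in> lists X \<Longrightarrow> v \<in> lists X"
proof -
  assume "subseq v w" "w \<in> lists X"
  then have "set v \<subseteq> set w" by (auto elim: list_emb_set)
  with \<open>w \<in> lists X\<close> show "v \<in> lists X" by (auto simp: lists_eq_set)
qed

lemma finite_minimal_words: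
  assumes "finite X" "P \<subseteq> lists X"
    and short: "\<And>u. u \<in> P \<Longrightarrow> \<exists>v\<in>P. subseq v u \<and> length v \<le> N"
  shows "finite (minimal_words P)"
proof (rule finite_subset)
  show "minimal_words P \<subseteq> {u. set u \<subseteq> X \<and> length u \<le> N}"
  proof
    fix u assume u: "u \<in> minimal_words P"
    then obtain v where "v \<in> P" "subseq v u" "length v \<le> N"
      using short unfolding minimal_words_def by blast
    then have "length u \<le> N" using u unfolding minimal_words_def by blast
    then show "u \<in> {u. set u \<subseteq> X \<and> length u \<le> N}"
      using u assms(2) unfolding minimal_words_def lists_eq_set by blast
  qed
qed (rule finite_lists_length_le[OF assms(1)])

lemma finite_minimal_final:
  assumes "finite Y" "finite (states A)"
    and closed: "\<forall>(p, c, s)\<in>transitions A. s \<in> states A" and "i \<in> states A"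
  shows "finite (minimal_final A Y i)"
  unfolding minimal_final_def
proof (rule finite_minimal_words[where X = "Inr ` Y" and N = "card (states A)"])
  fix u assume "u \<in> {u \<in> lists (Inr ` Y). \<exists>f\<in>final A. nfa_path A i u f}"
  then obtain f where "u \<in> lists (Inr ` Y)" "f \<in> final A" "nfa_path A i u f" by blast
  moreover then obtain v where "subseq v u" "nfa_path A i v f" "length v \<le> card (states A)"
    using nfa_path_short_subseq[OF assms(2) closed _ assms(4)] by blast
  ultimately show "\<exists>v\<in>{u \<in> lists (Inr ` Y). \<exists>f\<in>final A. nfa_path A i u f}.
      subseq v u \<and> length v \<le> card (states A)"
    using subseq_lists by blast
qed (use \<open>finite Y\<close> in auto)

lemma finite_minimal_trans:
  assumes "finite Y" "finite (states A)"
    and closed: "\<forall>(p, c, s)\<in>transitions A. s \<in> states A" and "i \<in> states A"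
  shows "finite (minimal_trans A Y i a j)"
  unfolding minimal_trans_def
proof (rule finite_minimal_words[where X = "insert (Inl a) (Inr ` Y)" and N = "2 * card (states A) + 1"])
  show "{u \<in> letter_words Y a. nfa_path A i u j} \<subseteq> lists (insert (Inl a) (Inr ` Y))"
    by (auto simp: letter_words_def)
next
  fix u assume "u \<in> {u \<in> letter_words Y a. nfa_path A i u j}"
  then obtain v w where u: "u = v @ [Inl a] @ w" "v \<in> lists (Inr ` Y)" "w \<in> lists (Inr ` Y)"
    and "nfa_path A i (v @ [Inl a] @ w) j"
    unfolding letter_words_def by blast
  then obtain s t where
    p: "nfa_path A i v s" "(s, Inl a, t) \<in> transitions A" "nfa_path A t w j"
    unfolding nfa_path_append by auto
  obtain v' where v': "subseq v' v" "nfa_path A i v' s" "length v' \<le> card (states A)"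
    using nfa_path_short_subseq[OF assms(2) closed p(1) assms(4)] by blast
  have closed': "t \<in> states A" using closed p(2) by auto
  obtain w' where w': "subseq w' w" "nfa_path A t w' j" "length w' \<le> card (states A)"
    using nfa_path_short_subseq[OF assms(2) closed p(3) closed'] by blast
  have "v' @ [Inl a] @ w' \<in> letter_words Y a"
    using subseq_lists[OF v'(1) u(2)] subseq_lists[OF w'(1) u(3)] by (auto simp: letter_words_def)
  moreover have "nfa_path A i (v' @ [Inl a] @ w') j"
    using v'(2) w'(2) p(2) by (auto simp: nfa_path_append)
  moreover have "subseq (v' @ [Inl a] @ w') u"
    unfolding u(1) using v'(1) w'(1) by (intro list_emb_append_mono) auto
  moreover have "length (v' @ [Inl a] @ w') \<le> 2 * card (states A) + 1"
    using v'(3) w'(3) by simp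
  ultimately show "\<exists>v\<in>{u \<in> letter_words Y a. nfa_path A i u j}.
      subseq v u \<and> length v \<le> 2 * card (states A) + 1"
    by blast
qed (use \<open>finite Y\<close> in auto)

lemma equiv_follow_equiv: "equiv (states (position_automaton r)) (follow_equiv r)"
  by (rule equivI) (auto simp: follow_equiv_def refl_on_def sym_def trans_def)

lemma states_follow_automaton:
  "finite (states (follow_automaton r))" "states (follow_automaton r) \<noteq> {}"
proof -
  show "finite (states (follow_automaton r))"
    unfolding follow_automaton_def nfa_quotient_def
    using finite_quotient[of "states (position_automaton r)" "follow_equiv r"]
      equiv_type[OF equiv_follow_equiv, of r]
    by (simp add: position_automaton_def)
  show "states (follow_automaton r) \<noteq> {}"
    by (auto simp: follow_automaton_def nfa_quotient_def position_automaton_def quotient_def)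
qed

lemma transitions_follow_automaton:
  "\<forall>(C, x, D)\<in>transitions (follow_automaton r). D \<in> states (follow_automaton r)"
  by (auto simp add: follow_automaton_def nfa_quotient_def)

lemma finite_fuzzy_follow_automaton:
  assumes "finite Y" and "C \<in> states (follow_automaton r)"
  shows "finite (minimal_trans (follow_automaton r) Y C a D)"
    and "finite (minimal_final (follow_automaton r) Y C)"
  using finite_minimal_trans[OF assms(1) states_follow_automaton(1) transitions_follow_automaton assms(2)]
    finite_minimal_final[OF assms(1) states_follow_automaton(1) transitions_follow_automaton assms(2)]
  by simp_all

end

theory Submission
  imports Defs
begin

text \<open>
  Both fuzzy languages send \<open>u\<close> to the join of the values of the words of \<open>lang (ordinary_regex Y val r)\<close>
  that become \<open>u\<close> when the letters of \<open>Y\<close> are erased. The follow automaton accepts this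
  language because the marked language is local and the states of a class have the same continuations.
  Restricting the joins to minimal words is harmless, since by integrality a subword has
  a larger value. As \<open>L\<close> is not complete, infinite joins need not commute with multiplication;
  but every join that occurs is already attained by finitely many words, so multiplication
  preserves it. This is expressed by \<open>stable_lub\<close>, which is closed under products and
  unions without reference to the finite subsets.
\<close>

section \<open>Stable least upper bounds\<close>

text \<open>This is a least upper bound that survives multiplication on either side;
  \<open>a = c = 1\<close> gives the ordinary one. Both contexts are quantified at once because the
  product is not commutative.\<close>

definition stable_lub :: "'l::lattice_ordered_monoid set \<Rightarrow> 'l \<Rightarrow> bool" where
  "stable_lub S s \<longleftrightarrow> (\<forall>a c b. a * s * c \<le> b \<longleftrightarrow> (\<forall>x\<in>S. a * x * c \<le> b))"

lemma stable_lub_unique: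
  assumes "stable_lub S s" "stable_lub S t"
  shows "s = t"
proof (rule order.antisym)
  have *: "u \<le> b \<longleftrightarrow> (\<forall>x\<in>S. x \<le> b)" if "stable_lub S u" for u b
    using that unfolding stable_lub_def by (metis mult.left_neutral mult.right_neutral)
  show "s \<le> t" "t \<le> s" using *[OF assms(1)] *[OF assms(2)] by blast+
qed

lemma stable_lub_upper:
  assumes "stable_lub S s" "x \<in> S"
  shows "x \<le> s"
  using assms unfolding stable_lub_def by (metis mult.left_neutral mult.right_neutral order.refl)

lemma stable_lub_empty: "stable_lub {} bot"
  by (simp add: stable_lub_def mult_bot_left mult_bot_right)

lemma stable_lub_singleton: "stable_lub {x} x"
  by (simp add: stable_lub_def)

lemma stable_lub_Un: "stable_lub S s \<Longrightarrow> stable_lub T t \<Longrightarrow> stable_lub (S \<union> T) (sup s t)"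
  by (auto simp: stable_lub_def mult_sup_distrib_left mult_sup_distrib_right)

text \<open>The index set may be infinite, as for the union over all powers in a star; only the
  outer bound has to be stable.\<close>

lemma stable_lub_UN:
  assumes "\<And>i. i \<in> I \<Longrightarrow> stable_lub (S i) (f i)" "stable_lub (f ` I) s"
  shows "stable_lub (\<Union>i\<in>I. S i) s"
  using assms by (simp add: stable_lub_def)

text \<open>The factors are expanded one after the other: \<open>t * c\<close> is the right context
  while \<open>s\<close> is expanded, then \<open>a * x\<close> is the left context for
  \<open>t\<close>.\<close>

lemma stable_lub_mult:
  assumes "stable_lub S s" "stable_lub T t"
  shows "stable_lub {x * y | x y. x \<in> S \<and> y \<in> T} (s * t)"
  unfolding stable_lub_def
proof (intro allI)
  fix a c b
  have "a * (s * t) * c \<le> b \<longleftrightarrow> a * s * (t * c) \<le> b" by (simp add: mult.assoc)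
  also have "\<dots> \<longleftrightarrow> (\<forall>x\<in>S. a * x * (t * c) \<le> b)"
    using assms(1) by (simp add: stable_lub_def)
  also have "\<dots> \<longleftrightarrow> (\<forall>x\<in>S. (a * x) * t * c \<le> b)" by (simp add: mult.assoc)
  also have "\<dots> \<longleftrightarrow> (\<forall>x\<in>S. \<forall>y\<in>T. (a * x) * y * c \<le> b)"
    using assms(2) by (simp add: stable_lub_def)
  also have "\<dots> \<longleftrightarrow> (\<forall>x\<in>S. \<forall>y\<in>T. a * (x * y) * c \<le> b)" by (simp add: mult.assoc)
  also have "\<dots> \<longleftrightarrow> (\<forall>z\<in>{x * y | x y. x \<in> S \<and> y \<in> T}. a * z * c \<le> b)" by blast
  finally show "a * (s * t) * c \<le> b \<longleftrightarrow> \<dots>" .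
qed

text \<open>Carries stability from a dominating subset to the whole set: from powers of bounded
  exponent to all powers, and from minimal words to all words.\<close>

lemma stable_lub_extend:
  assumes "stable_lub S s" "S \<subseteq> T" "\<And>x. x \<in> T \<Longrightarrow> x \<le> s"
  shows "stable_lub T s"
  unfolding stable_lub_def
proof (intro allI iffI ballI)
  fix a c b x
  assume "a * s * c \<le> b" "x \<in> T"
  then show "a * x * c \<le> b"
    using assms(3) by (meson lom_mult_left_mono lom_mult_right_mono order.trans)
next
  fix a c b
  assume "\<forall>x\<in>T. a * x * c \<le> b"
  then show "a * s * c \<le> b"
    using assms(1,2) by (auto simp: stable_lub_def)
qed

lemma stable_lub_Sup_fin: "finite S \<Longrightarrow> stable_lub S (Sup_fin (insert bot S))"
proof (induction S rule: finite_induct)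
  case empty
  then show ?case by (simp add: stable_lub_empty)
next
  case (insert x S)
  have "Sup_fin (insert bot (insert x S)) = sup x (Sup_fin (insert bot S))"
    using insert.hyps by (simp add: insert_commute[of bot x])
  then show ?case
    using stable_lub_Un[OF stable_lub_singleton[of x] insert.IH] by simp
qed

lemma stable_lub_join: "finite S \<Longrightarrow> stable_lub S (join S)"
  by (simp add: join_finite stable_lub_Sup_fin)

text \<open>By \<open>fpow_bounded\<close> the powers with exponent at most \<open>length u\<close>
  dominate all others, so the infinite join is a finite one.\<close>

lemma stable_lub_fstar:
  fixes f :: "'a list \<Rightarrow> 'l::integral_lattice_ordered_monoid"
  shows "stable_lub (range (\<lambda>n. fpow f n u)) (fstar f u)"
proof -
  let ?S = "(\<lambda>m. fpow f m u) ` {..length u}"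
  have lub: "stable_lub (range (\<lambda>n. fpow f n u)) (Sup_fin (insert bot ?S))"
    using fpow_bounded[of f _ u] by (intro stable_lub_extend[OF stable_lub_Sup_fin]) auto
  \<comment> \<open>\<open>fstar\<close> is defined through \<open>join\<close>, so the bound must
    also be recognised as the ordinary least upper bound.\<close>
  have "isLub UNIV (range (\<lambda>n. fpow f n u)) (Sup_fin (insert bot ?S))"
    using fpow_bounded[of f _ u]
    by (auto simp: isLub_def leastP_def isUb_def setle_def setge_def intro!: Sup_fin.boundedI)
  then show ?thesis using lub by (simp add: fstar_def join_eqI)
qed


section \<open>Values of words\<close>

abbreviation word_lub ::
  "('y \<Rightarrow> 'l::lattice_ordered_monoid) \<Rightarrow> ('a + 'y) list set \<Rightarrow> 'l \<Rightarrow> bool" where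
  "word_lub val W s \<equiv> stable_lub (word_value val ` W) s"

lemma word_value_Nil [simp]: "word_value val [] = 1"
  by (simp add: word_value_def)

lemma word_value_Cons [simp]: "word_value val (x # w) = letter_value val x * word_value val w"
  by (simp add: word_value_def)

lemma word_value_append [simp]: "word_value val (v @ w) = word_value val v * word_value val w"
  by (simp add: word_value_def)

lemma word_lub_conc:
  assumes "word_lub val V s" "word_lub val W t"
  shows "word_lub val {v @ w | v w. v \<in> V \<and> w \<in> W} (s * t)"
proof -
  have "word_value val ` {v @ w | v w. v \<in> V \<and> w \<in> W}
      = {x * y | x y. x \<in> word_value val ` V \<and> y \<in> word_value val ` W}"
    by (auto 0 4 simp: image_iff)
  then show ?thesis using stable_lub_mult[OF assms] by simp
qed

lemma word_lub_UN:
  assumes "\<And>i. i \<in> I \<Longrightarrow> word_lub val (W i) (f i)" "stable_lub (f ` I) s"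
  shows "word_lub val (\<Union>i\<in>I. W i) s"
  using stable_lub_UN[of I "\<lambda>i. word_value val ` W i" f s] assms by (simp add: image_UN)

lemma word_value_antimono:
  fixes val :: "'y \<Rightarrow> 'l::integral_lattice_ordered_monoid"
  assumes "subseq v u"
  shows "word_value val u \<le> word_value val v"
  using assms
proof (induction rule: list_emb.induct)
  case (list_emb_Nil ys)
  then show ?case by (simp add: one_eq_top)
next
  case (list_emb_Cons xs ys y)
  have "letter_value val y * word_value val ys \<le> 1 * word_value val ys"
    by (rule lom_mult_right_mono) (simp add: one_eq_top)
  then show ?case using list_emb_Cons.IH by simp
next
  case (list_emb_Cons2 x y xs ys)
  then show ?case by (simp add: lom_mult_left_mono)
qed

section \<open>Minimal words\<close>

lemma minimal_word_below:
  assumes "u \<in> P"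
  shows "\<exists>v\<in>minimal_words P. subseq v u"
  using assms
proof (induction "length u" arbitrary: u rule: less_induct)
  case less
  show ?case
  proof (cases "u \<in> minimal_words P")
    case False
    then obtain v where v: "v \<in> P" "subseq v u" "v \<noteq> u"
      using less.prems by (auto simp: minimal_words_def)
    \<comment> \<open>A proper subword is strictly shorter, so the descent to a minimal word
      ends.\<close>
    then have "length v < length u"
      by (metis list_emb_length not_subseq_length subseq_same_length le_neq_implies_less)
    then show ?thesis using less.hyps v by (meson subseq_order.order_trans)
  qed auto
qed

lemma word_lub_minimal_words:
  fixes val :: "'y \<Rightarrow> 'l::integral_lattice_ordered_monoid"
  assumes "finite (minimal_words P)"
  shows "word_lub val P (join (word_value val ` minimal_words P))"
proof (rule stable_lub_extend)
  show lub: "word_lub val (minimal_words P) (join (word_value val ` minimal_words P))"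
    using assms by (intro stable_lub_join) simp
  show "word_value val ` minimal_words P \<subseteq> word_value val ` P"
    by (auto simp: minimal_words_def)
  fix x assume "x \<in> word_value val ` P"
  then obtain u where u: "u \<in> P" "x = word_value val u" by blast
  then obtain v where "v \<in> minimal_words P" "subseq v u"
    using minimal_word_below by blast
  then show "x \<le> join (word_value val ` minimal_words P)"
    using stable_lub_upper[OF lub] word_value_antimono u by (meson imageI order.trans)
qed


section \<open>The fuzzy language of an expression as a join over the ordinary language\<close>

definition erase :: "('a + 'y) list \<Rightarrow> 'a list" where
  "erase w = map projl (filter isl w)"

lemma erase_simps [simp]:
  "erase [] = []"
  "erase (Inl a # w) = a # erase w"
  "erase (Inr y # w) = erase w"
  "erase (v @ w) = erase v @ erase w"
  by (simp_all add: erase_def)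

lemma erase_Inr: "w \<in> lists (Inr ` Y) \<Longrightarrow> erase w = []"
  by (induction w) auto

text \<open>A word over \<Sigma> and \<open>Y\<close> contributes its value at its erasure. Stable
  bounds being unique, \<open>val\<close> and \<open>W\<close> determine \<open>f\<close>, so two
  fuzzy languages are equal once they represent the same \<open>W\<close>.\<close>

definition represents ::
  "('y \<Rightarrow> 'l::lattice_ordered_monoid) \<Rightarrow> ('a + 'y) list set \<Rightarrow> ('a list \<Rightarrow> 'l) \<Rightarrow> bool" where
  "represents val W f \<longleftrightarrow> (\<forall>u. word_lub val {w \<in> W. erase w = u} (f u))"

lemma represents_Nil:
  fixes val :: "'y \<Rightarrow> 'l::integral_lattice_ordered_monoid"
  shows "represents val {[]} (fchar [])"
proof -
  have "{w \<in> {[] :: ('a + 'y) list}. erase w = u} = (if u = [] then {[]} else {})" for u :: "'a list"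
    by auto
  then show ?thesis
    \<comment> \<open>The empty word has value \<open>1\<close> while \<open>fchar\<close> yields
      \<open>top\<close>; integrality identifies the two.\<close>
    by (auto simp: represents_def fchar_def stable_lub_empty stable_lub_singleton simp flip: one_eq_top)
qed

lemma represents_Inl:
  fixes val :: "'y \<Rightarrow> 'l::integral_lattice_ordered_monoid"
  shows "represents val {[Inl a]} (fchar [a])"
proof -
  have "{w \<in> {[Inl a :: 'a + 'y]}. erase w = u} = (if u = [a] then {[Inl a]} else {})" for u
    by auto
  then show ?thesis
    by (auto simp: represents_def fchar_def stable_lub_empty stable_lub_singleton letter_value_def
        simp flip: one_eq_top)
qed

lemma represents_Un:
  assumes "represents val V f" "represents val W g"
  shows "represents val (V \<union> W) (\<lambda>u. sup (f u) (g u))"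
proof -
  have "{w \<in> V \<union> W. erase w = u} = {w \<in> V. erase w = u} \<union> {w \<in> W. erase w = u}" for u
    by auto
  then show ?thesis
    using assms by (simp add: represents_def image_Un stable_lub_Un)
qed

text \<open>The products erasing to \<open>u\<close> are sorted by the erasures of their two
  factors. A word has finitely many splits, so the join in \<open>fconc\<close> is finite and
  therefore stable.\<close>

lemma represents_fconc:
  fixes f g :: "'b list \<Rightarrow> 'l::lattice_ordered_monoid"
  assumes "represents val V f" "represents val W g"
  shows "represents val {v @ w | v w. v \<in> V \<and> w \<in> W} (fconc f g)"
  unfolding represents_def
proof
  fix u :: "'b list"
  let ?S = "{(x, y). u = x @ y}"
  let ?W = "\<lambda>(x, y). {v @ w | v w. v \<in> {v \<in> V. erase v = x} \<and> w \<in> {w \<in> W. erase w = y}}"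
  let ?f = "\<lambda>(x, y). f x * g y"
  have "{f x * g y | x y. u = x @ y} = ?f ` ?S" by auto
  then have "stable_lub (?f ` ?S) (fconc f g u)"
    using stable_lub_join[OF finite_split_products[of f g u]] by (simp add: fconc_def)
  moreover have "word_lub val (?W i) (?f i)" for i
    using assms by (cases i) (simp only: split_conv, intro word_lub_conc; simp add: represents_def)
  ultimately have "word_lub val (\<Union>i\<in>?S. ?W i) (fconc f g u)"
    by (intro word_lub_UN)
  moreover have "(\<Union>i\<in>?S. ?W i) = {w \<in> {v @ w | v w. v \<in> V \<and> w \<in> W}. erase w = u}"
  proof (intro equalityI subsetI)
    fix x assume "x \<in> {w \<in> {v @ w | v w. v \<in> V \<and> w \<in> W}. erase w = u}"
    then obtain v w where "x = v @ w" "v \<in> V" "w \<in> W" "u = erase v @ erase w" by auto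
    then show "x \<in> (\<Union>i\<in>?S. ?W i)"
      by (intro UN_I[of "(erase v, erase w)"]) auto
  qed auto
  ultimately show "word_lub val {w \<in> {v @ w | v w. v \<in> V \<and> w \<in> W}. erase w = u} (fconc f g u)"
    by simp
qed

lemma represents_fpow:
  fixes val :: "'y \<Rightarrow> 'l::integral_lattice_ordered_monoid"
  assumes "represents val W f"
  shows "represents val {concat ws | ws. ws \<in> lists W \<and> length ws = n} (fpow f n)"
proof (induction n)
  case 0
  have "{concat ws | ws. ws \<in> lists W \<and> length ws = 0} = {[]}" by auto
  then show ?case using represents_Nil by simp
next
  case (Suc n)
  have "{concat ws | ws. ws \<in> lists W \<and> length ws = Suc n}
      = {v @ w | v w. v \<in> {concat ws | ws. ws \<in> lists W \<and> length ws = n} \<and> w \<in> W}" (is "?L = ?R")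
  proof (intro equalityI subsetI)
    fix x assume "x \<in> ?L"
    then obtain ws where ws: "x = concat ws" "ws \<in> lists W" "length ws = Suc n" by blast
    then obtain vs w where "ws = vs @ [w]" by (metis length_Suc_conv_rev)
    with ws show "x \<in> ?R" by auto
  next
    fix x assume "x \<in> ?R"
    then obtain ws w where "x = concat (ws @ [w])" "ws @ [w] \<in> lists W" "length (ws @ [w]) = Suc n"
      by auto
    then show "x \<in> ?L" by blast
  qed
  then show ?case using represents_fconc[OF Suc assms] by simp
qed

lemma represents_fstar:
  fixes val :: "'y \<Rightarrow> 'l::integral_lattice_ordered_monoid"
  assumes "represents val W f"
  shows "represents val (concat ` lists W) (fstar f)"
  unfolding represents_def
proof
  fix u
  let ?W = "\<lambda>n. {w \<in> {concat ws | ws. ws \<in> lists W \<and> length ws = n}. erase w = u}"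
  \<comment> \<open>The words are sorted by their number of factors; a word may occur for several
    \<open>n\<close>, which does not affect the join.\<close>
  have "word_lub val (\<Union>n\<in>UNIV. ?W n) (fstar f u)"
    by (rule word_lub_UN[OF _ stable_lub_fstar])
      (use represents_fpow[OF assms] in \<open>simp add: represents_def\<close>)
  moreover have "(\<Union>n\<in>UNIV. ?W n) = {w \<in> concat ` lists W. erase w = u}" by auto
  ultimately show "word_lub val {w \<in> concat ` lists W. erase w = u} (fstar f u)" by simp
qed

lemma represents_ordinary:
  fixes val :: "'y \<Rightarrow> 'l::integral_lattice_ordered_monoid"
  assumes "\<And>l. l \<in> scalars r \<Longrightarrow> val (c l) = l"
  shows "represents val (lang (ordinary c r)) (regex_language r)"
  using assms
proof (induction r)
  case FEmpty
  then show ?case by (simp add: represents_def stable_lub_empty)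
next
  case FEps
  then show ?case by (simp add: represents_Nil)
next
  case (FLetter a)
  then show ?case by (simp add: represents_Inl)
next
  case (FScalar l r)
  show ?case
    unfolding represents_def
  proof
    fix u
    \<comment> \<open>The letter for \<open>l\<close> has value \<open>l\<close> and is erased, so
      prefixing it multiplies the value by \<open>l\<close> and keeps the erasure.\<close>
    have "word_lub val {[Inr (c l)]} l"
      using FScalar.prems by (simp add: letter_value_def stable_lub_singleton)
    moreover have "word_lub val {w \<in> lang (ordinary c r). erase w = u} (regex_language r u)"
      using FScalar by (simp add: represents_def)
    ultimately have "word_lub val
        {v @ w | v w. v \<in> {[Inr (c l)]} \<and> w \<in> {w \<in> lang (ordinary c r). erase w = u}}
        (l * regex_language r u)"
      by (rule word_lub_conc)
    moreover have "{v @ w | v w. v \<in> {[Inr (c l)]} \<and> w \<in> {w \<in> lang (ordinary c r). erase w = u}}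
        = {w \<in> lang (ordinary c (FScalar l r)). erase w = u}"
      by auto
    ultimately show "word_lub val {w \<in> lang (ordinary c (FScalar l r)). erase w = u}
        (regex_language (FScalar l r) u)"
      by simp
  qed
next
  case (FPlus r s)
  then show ?case by (simp add: represents_Un)
next
  case (FTimes r s)
  then show ?case by (simp add: represents_fconc)
next
  case (FStar r)
  then show ?case by (simp add: represents_fstar)
qed


section \<open>The language of the follow automaton\<close>

lemma lang_subset_occurrences: "w \<in> lang r \<Longrightarrow> set w \<subseteq> set (occurrences r)"
proof (induction r arbitrary: w)
  case (Star r)
  then show ?case by (fastforce simp: in_lists_conv_set)
qed fastforce+

lemma lang_map_regex: "lang (map_regex f r) = map f ` lang r"
proof (induction r)
  case (Times r s)
  then show ?case by (auto simp: image_iff) (metis map_append)+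
next
  case (Star r)
  then show ?case by (simp add: lists_image image_image map_concat)
qed auto

lemma occurrences_mark: "occurrences (mark k r) = [Suc k..<Suc k + length (occurrences r)]"
proof (induction r arbitrary: k)
  case (Plus r s)
  then show ?case using upt_add_eq_append[of "Suc k" "Suc k + length (occurrences r)"]
    by (simp add: add.assoc)
next
  case (Times r s)
  then show ?case using upt_add_eq_append[of "Suc k" "Suc k + length (occurrences r)"]
    by (simp add: add.assoc)
qed auto

text \<open>The offset \<open>k\<close> is kept general so that the induction reaches the right
  operand, whose positions begin after those of the left one.\<close>

lemma map_regex_mark:
  assumes "\<And>j. j < length (occurrences r) \<Longrightarrow> f (Suc (k + j)) = occurrences r ! j"
  shows "map_regex f (mark k r) = r"
  using assms
proof (induction r arbitrary: k)
  case (Letter x)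
  then show ?case by force
next
  case (Plus r s)
  have "map_regex f (mark k r) = r"
    using Plus.prems by (intro Plus.IH) (metis length_append nth_append occurrences.simps(4) trans_less_add1)
  moreover have "map_regex f (mark (k + length (occurrences r)) s) = s"
  proof (rule Plus.IH)
    fix j assume "j < length (occurrences s)"
    then show "f (Suc (k + length (occurrences r) + j)) = occurrences s ! j"
      using Plus.prems[of "length (occurrences r) + j"] by (simp add: add.assoc)
  qed
  ultimately show ?case by simp
next
  case (Times r s)
  have "map_regex f (mark k r) = r"
    using Times.prems by (intro Times.IH) (metis length_append nth_append occurrences.simps(5) trans_less_add1)
  moreover have "map_regex f (mark (k + length (occurrences r)) s) = s"
  proof (rule Times.IH)
    fix j assume "j < length (occurrences s)"
    then show "f (Suc (k + length (occurrences r) + j)) = occurrences s ! j"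
      using Times.prems[of "length (occurrences r) + j"] by (simp add: add.assoc)
  qed
  ultimately show ?case by simp
qed auto

lemma map_letter_at_marked_lang: "map (letter_at r) ` marked_lang r = lang r"
  unfolding marked_lang_def lang_map_regex[symmetric]
  by (subst map_regex_mark) (auto simp: letter_at_def)

lemma marked_lang_positions: "w \<in> marked_lang r \<Longrightarrow> set w \<subseteq> {1..length (occurrences r)}"
  using lang_subset_occurrences[of w "mark 0 r"]
  by (auto simp: marked_lang_def occurrences_mark)

section \<open>Locality of the marked language\<close>

text \<open>Words through a common letter can be recombined there: this says that the language is local.\<close>

definition interchangeable :: "'c list set \<Rightarrow> bool" where
  "interchangeable L \<longleftrightarrow> (\<forall>u v u' v' i. u @ i # v \<in> L \<longrightarrow> u' @ i # v' \<in> L \<longrightarrow> u @ i # v' \<in> L)"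

lemma interchangeable_conc:
  assumes "interchangeable V" "interchangeable W"
    and "\<Union>(set ` V) \<inter> \<Union>(set ` W) = {}"
  shows "interchangeable {v @ w | v w. v \<in> V \<and> w \<in> W}"
  unfolding interchangeable_def
proof (intro allI impI)
  fix u v u' v' i
  assume "u @ i # v \<in> {v @ w | v w. v \<in> V \<and> w \<in> W}" "u' @ i # v' \<in> {v @ w | v w. v \<in> V \<and> w \<in> W}"
  then obtain x y x' y' where
    xy: "u @ i # v = x @ y" "x \<in> V" "y \<in> W" and xy': "u' @ i # v' = x' @ y'" "x' \<in> V" "y' \<in> W"
    by blast
  \<comment> \<open>The distinguished letter lies either in the left or in the right factor.\<close>
  have split: "(\<exists>t. p = q @ i # t \<and> b = t @ z) \<or> (\<exists>t. q = p @ t \<and> z = t @ i # b)"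
    if "q @ i # b = p @ z" for q b p z
    using that by (auto simp: append_eq_append_conv2 Cons_eq_append_conv append_eq_Cons_conv)
  \<comment> \<open>Since the alphabets are disjoint, \<open>i\<close> falls in the same factor of
    both words; the mixed cases are impossible.\<close>
  consider t t' where "x = u @ i # t" "x' = u' @ i # t'" "v' = t' @ y'"
    | t t' where "u = x @ t" "y = t @ i # v" "y' = t' @ i # v'"
    using split[OF xy(1)] split[OF xy'(1)] xy xy' assms(3) by fastforce
  then show "u @ i # v' \<in> {v @ w | v w. v \<in> V \<and> w \<in> W}"
  proof cases
    case 1
    then have "u @ i # t' \<in> V" using assms(1) xy(2) xy'(2) unfolding interchangeable_def by blast
    moreover have "u @ i # v' = (u @ i # t') @ y'" using 1 by simp
    ultimately show ?thesis using xy'(3) by blast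
  next
    case 2
    then have "t @ i # v' \<in> W" using assms(2) xy(3) xy'(3) unfolding interchangeable_def by blast
    moreover have "u @ i # v' = x @ (t @ i # v')" using 2 by simp
    ultimately show ?thesis using xy(2) by blast
  qed
qed

lemma concat_eq_append_Cons:
  assumes "concat ws = u @ i # v"
  shows "\<exists>us p q vs. ws = us @ (p @ i # q) # vs \<and> u = concat us @ p \<and> v = q @ concat vs"
  using assms
proof (induction ws arbitrary: u)
  case (Cons w ws)
  then consider t where "w = u @ i # t" "v = t @ concat ws"
    | t where "u = w @ t" "concat ws = t @ i # v"
    by (auto simp: append_eq_append_conv2 Cons_eq_append_conv append_eq_Cons_conv)
  then show ?case
  proof cases
    case 1
    then show ?thesis
      by (intro exI[of _ "[]"] exI[of _ u] exI[of _ t] exI[of _ ws]) simp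
  next
    case 2
    from Cons.IH[OF 2(2)] obtain us p q vs
      where "ws = us @ (p @ i # q) # vs" "t = concat us @ p" "v = q @ concat vs" by blast
    then show ?thesis using 2 
      by (intro exI[of _ "w # us"] exI[of _ p] exI[of _ q] exI[of _ vs]) simp
  qed
qed simp

text \<open>Only the two factors that contain \<open>i\<close> are recombined; the factors before
  come from the first word, those after from the second.\<close>

lemma interchangeable_star:
  assumes "interchangeable L"
  shows "interchangeable (concat ` lists L)"
  unfolding interchangeable_def
proof (intro allI impI)
  fix u v u' v' i
  assume "u @ i # v \<in> concat ` lists L" "u' @ i # v' \<in> concat ` lists L"
  then obtain ws ws' where ws: "concat ws = u @ i # v" "ws \<in> lists L"
    and ws': "concat ws' = u' @ i # v'" "ws' \<in> lists L"
    by (metis imageE)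
  obtain us p q vs where 1: "ws = us @ (p @ i # q) # vs" "u = concat us @ p"
    using concat_eq_append_Cons[OF ws(1)] by blast
  obtain us' p' q' vs' where 2: "ws' = us' @ (p' @ i # q') # vs'" "v' = q' @ concat vs'"
    using concat_eq_append_Cons[OF ws'(1)] by blast
  have "p @ i # q' \<in> L"
    using assms 1 2 ws(2) ws'(2) unfolding interchangeable_def by (metis append_in_lists_conv Cons_in_lists_iff)
  then have "us @ (p @ i # q') # vs' \<in> lists L" using 1 2 ws(2) ws'(2) by simp
  moreover have "u @ i # v' = concat (us @ (p @ i # q') # vs')" using 1 2 by simp
  ultimately show "u @ i # v' \<in> concat ` lists L" by blast
qed

text \<open>Glushkov's observation that linear expressions denote local languages. Distinct
  occurrences give the operands disjoint alphabets, so two words of a sum that share a letter come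
  from the same summand.\<close>

lemma interchangeable_lang: "distinct (occurrences r) \<Longrightarrow> interchangeable (lang r)"
proof (induction r)
  case (Letter c)
  then show ?case by (auto simp: interchangeable_def append_eq_Cons_conv)
next
  case (Plus r s)
  then have IH: "interchangeable (lang r)" "interchangeable (lang s)"
    and dis: "set (occurrences r) \<inter> set (occurrences s) = {}" by auto
  have "\<not> (u @ i # v \<in> lang r \<and> u' @ i # v' \<in> lang s)" for u v u' v' i
    using dis lang_subset_occurrences[of "u @ i # v" r] lang_subset_occurrences[of "u' @ i # v'" s]
    by auto
  then show ?case using IH unfolding interchangeable_def lang.simps by blast
next
  case (Times r s)
  then have "interchangeable {v @ w | v w. v \<in> lang r \<and> w \<in> lang s}"
    using lang_subset_occurrences[of _ r] lang_subset_occurrences[of _ s]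
    by (intro interchangeable_conc) (simp, simp, fastforce)
  then show ?case by simp
next
  case (Star r)
  then show ?case by (simp add: interchangeable_star)
qed (simp_all add: interchangeable_def)

lemma marked_lang_recombine:
  assumes "u @ i # v \<in> marked_lang r" "u' @ i # v' \<in> marked_lang r"
  shows "u @ i # v' \<in> marked_lang r"
proof -
  have "interchangeable (marked_lang r)"
    unfolding marked_lang_def by (rule interchangeable_lang) (simp add: occurrences_mark)
  then show ?thesis using assms unfolding interchangeable_def by blast
qed

section \<open>Marked words as runs of the position automaton\<close>

lemma zero_notin_marked: "w \<in> marked_lang r \<Longrightarrow> 0 \<notin> set w"
  using marked_lang_positions[of w r] by (meson atLeastAtMost_iff not_one_le_zero subsetD)

lemma follow_subset: "follow r i \<subseteq> {1..length (occurrences r)}"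
proof
  fix j assume "j \<in> follow r i"
  then obtain w where "w \<in> marked_lang r" "j \<in> set w"
    by (fastforce simp: follow_def split: if_splits)
  then show "j \<in> {1..length (occurrences r)}" using marked_lang_positions by blast
qed

text \<open>In the position automaton the state reached is the position just read, so
  \<open>0 # w\<close> is the run on \<open>w\<close>. The direction from runs to words rests on
  locality.\<close>

lemma marked_lang_iff:
  "w \<in> marked_lang r \<longleftrightarrow> successively (\<lambda>i j. j \<in> follow r i) (0 # w) \<and> last (0 # w) \<in> last_pos r"
    (is "_ \<longleftrightarrow> successively ?F _ \<and> _")
proof
  assume w: "w \<in> marked_lang r"
  have suffix: "successively ?F (i # v)" if "u @ i # v \<in> marked_lang r" for u i v
    using that
  proof (induction v arbitrary: u i)
    case (Cons j v)
    \<comment> \<open>Positions start at 1 and \<open>0\<close> is reserved for the initial state,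
      so the second branch of \<open>follow\<close> applies.\<close>
    have "i \<noteq> 0" using zero_notin_marked[OF Cons.prems] by auto
    then have "j \<in> follow r i" using Cons.prems by (auto simp: follow_def)
    moreover have "successively ?F (j # v)" using Cons.IH[of "u @ [i]" j] Cons.prems by simp
    ultimately show ?case by simp
  qed simp
  show "successively ?F (0 # w) \<and> last (0 # w) \<in> last_pos r"
  proof (cases w)
    case Nil
    then show ?thesis using w by (simp add: last_pos_def)
  next
    case (Cons i v)
    then have "i \<in> follow r 0" using w by (auto simp: follow_def)
    moreover have "w \<noteq> []" using Cons by simp
    then have "butlast w @ [last w] \<in> marked_lang r" using w by simp
    then have "last w \<in> last_pos r" unfolding last_pos_def by blast
    ultimately show ?thesis using suffix[of "[]" i v] w Cons by simp
  qed
next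
  assume w: "successively ?F (0 # w) \<and> last (0 # w) \<in> last_pos r"
  \<comment> \<open>Every nonempty run from \<open>0\<close> spells a prefix of a marked word: the
    word witnessing \<open>j \<in> follow r i\<close> supplies a new tail, exchanged at
    \<open>i\<close>.\<close>
  have prefix: "\<exists>x. v @ x \<in> marked_lang r" if "v \<noteq> []" "successively ?F (0 # v)" for v
    using that
  proof (induction v rule: rev_induct)
    case (snoc j v)
    show ?case
    proof (cases v rule: rev_cases)
      case Nil
      then show ?thesis using snoc.prems by (auto simp: follow_def)
    next
      case (snoc u i)
      have step: "successively ?F (0 # v)" "j \<in> follow r i"
        using snoc.prems snoc by (auto simp: successively_append_iff successively_Cons hd_append
            split: if_splits)
      then obtain x where "v @ x \<in> marked_lang r" using snoc.IH snoc by blast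
      then have x: "u @ i # x \<in> marked_lang r" using snoc by simp
      then have "i \<noteq> 0" using zero_notin_marked[OF x] by auto
      then obtain v' w' where "v' @ i # j # w' \<in> marked_lang r"
        using step(2) by (auto simp: follow_def)
      then have "u @ i # j # w' \<in> marked_lang r" using marked_lang_recombine x by blast
      then show ?thesis using snoc by auto
    qed
  qed simp
  show "w \<in> marked_lang r"
  proof (cases w rule: rev_cases)
    case Nil
    \<comment> \<open>Hence \<open>0\<close> can be in \<open>last_pos r\<close> only because the
      empty word is in the language.\<close>
    have "v @ [0] \<notin> marked_lang r" for v using zero_notin_marked[of "v @ [0]" r] by auto
    then show ?thesis using w Nil by (auto simp: last_pos_def split: if_splits)
  next
    case (snoc u i)
    then obtain x where x: "u @ i # x \<in> marked_lang r" using prefix[of w] w by auto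
    then have "i \<noteq> 0" using zero_notin_marked[OF x] by auto
    then obtain v where "v @ [i] \<in> marked_lang r" using w snoc by (auto simp: last_pos_def split: if_splits)
    \<comment> \<open>A word ending in \<open>i\<close> allows the tail \<open>x\<close> to be
      exchanged for the empty one.\<close>
    then show ?thesis using marked_lang_recombine x snoc by blast
  qed
qed

section \<open>Paths and acceptance in the follow automaton\<close>

lemma follow_automaton_path_iff:
  assumes "C \<in> states (follow_automaton r)" "i \<in> C"
  shows "nfa_path (follow_automaton r) C w D \<longleftrightarrow> D \<in> states (follow_automaton r) \<and>
    (\<exists>js. w = map (letter_at r) js \<and> successively (\<lambda>i j. j \<in> follow r i) (i # js) \<and> last (i # js) \<in> D)"
  using assms
proof (induction w arbitrary: C i)
  case Nil
  \<comment> \<open>Distinct classes are disjoint, and \<open>i\<close> lies in both.\<close>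
  have "C = D" if "D \<in> states (follow_automaton r)" "i \<in> D"
    using that Nil quotient_disj[OF equiv_follow_equiv]
    by (fastforce simp: follow_automaton_def nfa_quotient_def)
  then show ?case using Nil by auto
next
  case (Cons x w)
  \<comment> \<open>A transition of the quotient may start at any member of \<open>C\<close>. All
    members have the same follow set, so the fixed representative \<open>i\<close> can replace them
    and paths lift to sequences of positions.\<close>
  have trans: "(C, x, E) \<in> transitions (follow_automaton r) \<longleftrightarrow>
      E \<in> states (follow_automaton r) \<and> (\<exists>j\<in>E. x = letter_at r j \<and> j \<in> follow r i)" for E
  proof -
    have C: "C \<in> states (position_automaton r) // follow_equiv r"
      using Cons.prems by (simp add: follow_automaton_def nfa_quotient_def)
    have "follow r i' = follow r i" if "i' \<in> C" for i'
      using quotient_eq_iff[OF equiv_follow_equiv C C that Cons.prems(2)] by (simp add: follow_equiv_def)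
    moreover have "i \<le> length (occurrences r)"
      using in_quotient_imp_subset[OF equiv_follow_equiv C] Cons.prems(2)
      by (auto simp: position_automaton_def)
    moreover have "(C, x, E) \<in> transitions (follow_automaton r) \<longleftrightarrow>
        E \<in> states (follow_automaton r) \<and>
        (\<exists>i'\<in>C. \<exists>j\<in>E. i' \<le> length (occurrences r) \<and> x = letter_at r j \<and> j \<in> follow r i')"
      using Cons.prems(1) by (auto simp: follow_automaton_def nfa_quotient_def position_automaton_def)
    ultimately show ?thesis using Cons.prems(2) by metis
  qed
  \<comment> \<open>Conversely, each position that follows has a class, so sequences of positions
    project to paths.\<close>
  have ex: "\<exists>E\<in>states (follow_automaton r). j \<in> E" if "j \<in> follow r i" for j
  proof -
    have j: "j \<in> states (position_automaton r)"
      using that follow_subset[of r i] by (auto simp: position_automaton_def)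
    then have "j \<in> follow_equiv r `` {j}" by (rule equiv_class_self[OF equiv_follow_equiv])
    then show ?thesis using quotientI[OF j, of "follow_equiv r"]
      by (auto simp: follow_automaton_def nfa_quotient_def)
  qed
  show ?case (is "?L \<longleftrightarrow> ?R")
  proof
    assume ?L
    then obtain E j where E: "E \<in> states (follow_automaton r)" "j \<in> E" "x = letter_at r j"
      "j \<in> follow r i" "nfa_path (follow_automaton r) E w D"
      using trans by auto
    then obtain js where "D \<in> states (follow_automaton r)" "w = map (letter_at r) js"
      "successively (\<lambda>i j. j \<in> follow r i) (j # js)" "last (j # js) \<in> D"
      using Cons.IH[OF E(1,2)] by blast
    then show ?R using E by (intro conjI exI[of _ "j # js"]) auto
  next
    assume ?R
    then obtain j js where js: "D \<in> states (follow_automaton r)" "x = letter_at r j"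
      "w = map (letter_at r) js" "j \<in> follow r i"
      "successively (\<lambda>i j. j \<in> follow r i) (j # js)" "last (j # js) \<in> D"
      by (auto simp: Cons_eq_map_conv)
    obtain E where E: "E \<in> states (follow_automaton r)" "j \<in> E" using ex js(4) by blast
    then have "nfa_path (follow_automaton r) E w D" using Cons.IH js by blast
    moreover have "(C, x, E) \<in> transitions (follow_automaton r)" using trans E js by blast
    ultimately show ?L by auto
  qed
qed

lemma initial_follow_automaton:
  "initial (follow_automaton r) \<in> states (follow_automaton r)" "0 \<in> initial (follow_automaton r)"
proof -
  have "0 \<in> states (position_automaton r)" by (simp add: position_automaton_def)
  then show "initial (follow_automaton r) \<in> states (follow_automaton r)" "0 \<in> initial (follow_automaton r)"
    using quotientI[of 0 "states (position_automaton r)" "follow_equiv r"]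
      equiv_class_self[OF equiv_follow_equiv, of 0 r]
    by (simp_all add: follow_automaton_def nfa_quotient_def position_automaton_def)
qed

text \<open>The equivalence respects \<open>last_pos\<close>, so one element decides whether the
  whole class is final.\<close>

lemma final_follow_automaton:
  assumes "D \<in> states (follow_automaton r)" "j \<in> D"
  shows "D \<in> final (follow_automaton r) \<longleftrightarrow> j \<in> last_pos r"
proof -
  have D: "D \<in> states (position_automaton r) // follow_equiv r"
    using assms by (simp add: follow_automaton_def nfa_quotient_def)
  have "i \<in> last_pos r \<longleftrightarrow> j \<in> last_pos r" if "i \<in> D" for i
    using quotient_eq_iff[OF equiv_follow_equiv D D that assms(2)] by (simp add: follow_equiv_def)
  then have "D \<subseteq> last_pos r \<longleftrightarrow> j \<in> last_pos r" using assms(2) by blast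
  then show ?thesis
    using assms(1) by (simp add: follow_automaton_def nfa_quotient_def position_automaton_def)
qed

lemma final_subset_states: "final (follow_automaton r) \<subseteq> states (follow_automaton r)"
  by (auto simp: follow_automaton_def nfa_quotient_def)

text \<open>Lifting paths at the representative \<open>0\<close> of the initial class reduces
  acceptance to \<open>marked_lang_iff\<close>; reading letters off positions then undoes the
  marking.\<close>

lemma follow_automaton_accepts_iff:
  "(\<exists>D\<in>final (follow_automaton r). nfa_path (follow_automaton r) (initial (follow_automaton r)) w D)
    \<longleftrightarrow> w \<in> lang r" (is "?L \<longleftrightarrow> _")
proof -
  let ?F = "successively (\<lambda>i j. j \<in> follow r i)"
  have state: "\<exists>D\<in>states (follow_automaton r). last (0 # js) \<in> D" if "last (0 # js) \<in> last_pos r" for js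
  proof -
    have j: "last (0 # js) \<in> states (position_automaton r)"
      using that marked_lang_positions
      by (fastforce simp: last_pos_def position_automaton_def split: if_splits)
    then show ?thesis
      using quotientI[OF j, of "follow_equiv r"] equiv_class_self[OF equiv_follow_equiv j]
      unfolding follow_automaton_def nfa_quotient_def nfa.select_convs by blast
  qed
  have final: "(\<exists>D\<in>final (follow_automaton r). last (0 # js) \<in> D) \<longleftrightarrow> last (0 # js) \<in> last_pos r" for js
  proof
    assume "\<exists>D\<in>final (follow_automaton r). last (0 # js) \<in> D"
    then show "last (0 # js) \<in> last_pos r"
      using final_subset_states[of r] final_follow_automaton by (meson subsetD)
  next
    assume last: "last (0 # js) \<in> last_pos r"
    then obtain D where "D \<in> states (follow_automaton r)" "last (0 # js) \<in> D" using state by blast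
    then show "\<exists>D\<in>final (follow_automaton r). last (0 # js) \<in> D"
      using final_follow_automaton last by blast
  qed
  have "?L \<longleftrightarrow> (\<exists>D\<in>final (follow_automaton r). \<exists>js. w = map (letter_at r) js \<and> ?F (0 # js) \<and> last (0 # js) \<in> D)"
    unfolding follow_automaton_path_iff[OF initial_follow_automaton]
    using final_subset_states[of r] by (meson subsetD)
  also have "\<dots> \<longleftrightarrow> (\<exists>js. w = map (letter_at r) js \<and> ?F (0 # js) \<and>
      (\<exists>D\<in>final (follow_automaton r). last (0 # js) \<in> D))"
    by blast
  also have "\<dots> \<longleftrightarrow> (\<exists>js. w = map (letter_at r) js \<and> ?F (0 # js) \<and> last (0 # js) \<in> last_pos r)"
    by (simp only: final)
  also have "\<dots> \<longleftrightarrow> w \<in> map (letter_at r) ` marked_lang r"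
    by (auto simp only: marked_lang_iff image_iff Bex_def)
  finally show ?thesis by (simp only: map_letter_at_marked_lang)
qed


section \<open>The language of the fuzzy automaton\<close>

text \<open>
  \<open>ftrans_star\<close> at \<open>[]\<close> only reads the empty word, whereas scalars may precede the first letter of
  a nonempty word.
\<close>

definition block_words :: "'y set \<Rightarrow> 'a list \<Rightarrow> ('a + 'y) list set" where
  "block_words Y u =
     (if u = [] then {[]} else {w \<in> lists (range Inl \<union> Inr ` Y). erase w = u})"

lemma erase_eq_snoc:
  assumes "w \<in> lists (range Inl \<union> Inr ` Y)" "erase w = u @ [a]"
  shows "\<exists>p q. w = p @ Inl a # q \<and> p \<in> lists (range Inl \<union> Inr ` Y) \<and> erase p = u \<and> q \<in> lists (Inr ` Y)"
  using assms
proof (induction w rule: rev_induct)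
  case (snoc x w)
  show ?case
  proof (cases x)
    case (Inl b)
    then show ?thesis using snoc.prems by (intro exI[of _ w] exI[of _ "[]"]) auto
  next
    case (Inr y)
    then obtain p q where pq: "w = p @ Inl a # q" "p \<in> lists (range Inl \<union> Inr ` Y)"
      "erase p = u" "q \<in> lists (Inr ` Y)"
      using snoc by auto
    moreover have "x \<in> Inr ` Y" using snoc.prems Inr by auto
    ultimately show ?thesis by (intro exI[of _ p] exI[of _ "q @ [x]"]) auto
  qed
qed simp

lemma erase_eq_Nil:
  "w \<in> lists (range Inl \<union> Inr ` Y) \<Longrightarrow> erase w = [] \<Longrightarrow> w \<in> lists (Inr ` Y)"
  by (induction w) auto

lemma lists_Inr_subset: "w \<in> lists (Inr ` Y) \<Longrightarrow> w \<in> lists (range Inl \<union> Inr ` Y)"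
  using lists_mono[of "Inr ` Y" "range Inl \<union> Inr ` Y"] by blast

text \<open>Letters of \<open>Y\<close> between two letters of \<Sigma> may belong to either block.
  The decomposition is thus not unique, which is harmless because only sets of words are
  joined.\<close>

lemma block_words_snoc:
  "block_words Y (u @ [a]) = {v @ w | v w. v \<in> block_words Y u \<and> w \<in> letter_words Y a}"
    (is "?L = ?R")
proof (intro equalityI subsetI)
  fix x assume "x \<in> ?L"
  then obtain p q where x: "x = p @ Inl a # q" "p \<in> lists (range Inl \<union> Inr ` Y)" "erase p = u"
    "q \<in> lists (Inr ` Y)"
    using erase_eq_snoc[of x Y u a] by (auto simp: block_words_def)
  show "x \<in> ?R"
  \<comment> \<open>For empty \<open>u\<close> the left factor must be empty, so the leading letters
    of \<open>Y\<close> go into the block of \<open>a\<close>; otherwise they stay in the left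
    factor.\<close>
  proof (cases "u = []")
    case True
    then have "x \<in> letter_words Y a"
      using x erase_eq_Nil[OF x(2)] by (auto simp: letter_words_def)
    then show ?thesis using True by (auto simp: block_words_def)
  next
    case False
    have "Inl a # q \<in> letter_words Y a"
      using x(4) unfolding letter_words_def
      by (intro CollectI exI[of _ "[]"] exI[of _ q]) simp
    then show ?thesis using x False by (auto simp: block_words_def)
  qed
next
  fix x assume "x \<in> ?R"
  then obtain v p q where x: "x = v @ p @ [Inl a] @ q" "v \<in> block_words Y u"
    "p \<in> lists (Inr ` Y)" "q \<in> lists (Inr ` Y)"
    by (auto simp: letter_words_def)
  have "v \<in> lists (range Inl \<union> Inr ` Y)" "erase v = u"
    using x(2) by (auto simp: block_words_def split: if_splits)
  then show "x \<in> ?L"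
    using x(3,4)[THEN lists_Inr_subset] x(3,4)[THEN erase_Inr] x(1) by (simp add: block_words_def)
qed

lemma block_words_final:
  "{v @ w | v w. v \<in> block_words Y u \<and> w \<in> lists (Inr ` Y)}
    = {w \<in> lists (range Inl \<union> Inr ` Y). erase w = u}" (is "?L = ?R")
proof (intro equalityI subsetI)
  fix x assume "x \<in> ?L"
  then obtain v w where x: "x = v @ w" "v \<in> block_words Y u" "w \<in> lists (Inr ` Y)" by blast
  have "v \<in> lists (range Inl \<union> Inr ` Y)" "erase v = u"
    using x(2) by (auto simp: block_words_def split: if_splits)
  then show "x \<in> ?R"
    using x(3)[THEN lists_Inr_subset] x(3)[THEN erase_Inr] x(1) by simp
next
  fix x assume x: "x \<in> ?R"
  show "x \<in> ?L"
  \<comment> \<open>For empty \<open>u\<close> the final factor supplies the whole word; otherwise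
    it can be taken empty.\<close>
  proof (cases "u = []")
    case True
    then show ?thesis using x erase_eq_Nil[of x Y] by (auto simp: block_words_def)
  next
    case False
    then have "x \<in> block_words Y u" using x by (simp add: block_words_def)
    then show ?thesis by force
  qed
qed

section \<open>Weights of the fuzzy automaton as joins over path labels\<close>

lemma nfa_path_states:
  assumes "\<forall>(p, c, s)\<in>transitions A. s \<in> states A" "p \<in> states A" "nfa_path A p w q"
  shows "q \<in> states A"
  using assms(2,3)
proof (induction w arbitrary: p)
  case (Cons c w)
  then show ?case using assms(1) by auto
qed simp

text \<open>Paths are cut at the state \<open>E\<close> reached before the last block. There are
  finitely many states, so the join over \<open>E\<close> is stable.\<close>

lemma word_lub_ftrans_star:
  fixes Y :: "'y set" and val :: "'y \<Rightarrow> 'l::integral_lattice_ordered_monoid"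
    and r :: "('a, 'l) fuzzy_regex"
  defines "F \<equiv> follow_automaton (ordinary_regex Y val r)"
  assumes "finite Y" "C \<in> states F"
  shows "word_lub val {w \<in> block_words Y u. nfa_path F C w D}
    (ftrans_star (fuzzy_follow_automaton Y val r) C u D)"
proof (induction u arbitrary: D rule: rev_induct)
  case Nil
  have "{w \<in> block_words Y []. nfa_path F C w D} = (if C = D then {[]} else {})"
    by (auto simp: block_words_def)
  then show ?case
    by (auto simp: stable_lub_empty stable_lub_singleton simp flip: one_eq_top)
next
  case (snoc a u)
  let ?A = "fuzzy_follow_automaton Y val r"
  let ?W = "\<lambda>E. {v @ w | v w. v \<in> {v \<in> block_words Y u. nfa_path F C v E}
      \<and> w \<in> {w \<in> letter_words Y a. nfa_path F E w D}}"
  let ?f = "\<lambda>E. ftrans_star ?A C u E * ftrans ?A E a D"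
  \<comment> \<open>The join over minimal words bounds all path labels, and only the full set of
    labels is compatible with concatenation.\<close>
  have trans: "word_lub val {w \<in> letter_words Y a. nfa_path F E w D} (ftrans ?A E a D)"
    if "E \<in> states F" for E
    using word_lub_minimal_words[of "{w \<in> letter_words Y a. nfa_path F E w D}" val]
      finite_fuzzy_follow_automaton(1)[OF assms(2), of E "ordinary_regex Y val r" a D] that
    by (simp add: F_def fuzzy_follow_automaton_def minimal_trans_def Let_def)
  have "ftrans_star ?A C (u @ [a]) D = join (?f ` states F)"
    by (simp add: F_def fuzzy_follow_automaton_def Setcompr_eq_image Let_def)
  then have "stable_lub (?f ` states F) (ftrans_star ?A C (u @ [a]) D)"
    using states_follow_automaton(1)[of "ordinary_regex Y val r"] by (simp only: F_def stable_lub_join finite_imageI)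
  then have "word_lub val (\<Union>E\<in>states F. ?W E) (ftrans_star ?A C (u @ [a]) D)"
    by (rule word_lub_UN[rotated]) (intro word_lub_conc snoc.IH trans)
  moreover have "(\<Union>E\<in>states F. ?W E) = {w \<in> block_words Y (u @ [a]). nfa_path F C w D}"
    using nfa_path_states[OF transitions_follow_automaton assms(3)[unfolded F_def]]
    by (fastforce simp: block_words_snoc nfa_path_append F_def)
  ultimately show ?case by simp
qed

text \<open>The type of scalar letters may be larger than \<open>Y\<close>, whereas the automaton is
  built from words over \<Sigma> and \<open>Y\<close>; hence the intersection.\<close>

lemma represents_fuzzy_follow_automaton:
  fixes Y :: "'y set" and val :: "'y \<Rightarrow> 'l::integral_lattice_ordered_monoid"
    and r :: "('a, 'l) fuzzy_regex"
  defines "R \<equiv> ordinary_regex Y val r"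
  assumes "finite Y"
  shows "represents val (lang R \<inter> lists (range Inl \<union> Inr ` Y))
    (automaton_language (fuzzy_follow_automaton Y val r))"
  unfolding represents_def
proof
  fix u
  let ?A = "fuzzy_follow_automaton Y val r"
  let ?F = "follow_automaton R"
  let ?S = "states ?F"
  \<comment> \<open>The initial weight is also encoded as a language, so that all three weights
    become factors of a concatenation.\<close>
  let ?I = "\<lambda>C. if C = initial ?F then {[]} else {} :: ('a + 'y) list set"
  let ?P = "\<lambda>C D. {w \<in> block_words Y u. nfa_path ?F C w D}"
  let ?T = "\<lambda>D. {w \<in> lists (Inr ` Y). \<exists>E\<in>final ?F. nfa_path ?F D w E}"
  let ?W = "\<lambda>(C, D). {v @ w | v w. v \<in> {v @ w | v w. v \<in> ?I C \<and> w \<in> ?P C D} \<and> w \<in> ?T D}"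
  let ?f = "\<lambda>(C, D). finitial ?A C * ftrans_star ?A C u D * ffinal ?A D"
  have init: "word_lub val (?I C) (finitial ?A C)" for C
    by (auto simp: fuzzy_follow_automaton_def R_def stable_lub_empty stable_lub_singleton Let_def
        simp flip: one_eq_top)
  have path: "word_lub val (?P C D) (ftrans_star ?A C u D)" if "C \<in> ?S" for C D
    using word_lub_ftrans_star[OF assms(2)] that by (simp add: R_def)
  have fin: "word_lub val (?T D) (ffinal ?A D)" if "D \<in> ?S" for D
    using word_lub_minimal_words[of "?T D" val]
      finite_fuzzy_follow_automaton(2)[OF assms(2), of D R] that
    by (simp add: R_def fuzzy_follow_automaton_def minimal_final_def Let_def)
  have "fstates ?A = ?S" by (simp add: R_def fuzzy_follow_automaton_def Let_def)
  moreover have "{finitial ?A p * ftrans_star ?A p u q * ffinal ?A q | p q. p \<in> fstates ?A \<and> q \<in> fstates ?A}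
      = ?f ` (fstates ?A \<times> fstates ?A)"
    by (auto simp only: image_iff split: prod.splits)
  ultimately have "automaton_language ?A u = join (?f ` (?S \<times> ?S))"
    by (simp only: automaton_language_def)
  then have "stable_lub (?f ` (?S \<times> ?S)) (automaton_language ?A u)"
    using states_follow_automaton(1)[of R] by (simp only: stable_lub_join finite_imageI finite_cartesian_product)
  then have "word_lub val (\<Union>i\<in>?S \<times> ?S. ?W i) (automaton_language ?A u)"
  proof (rule word_lub_UN[rotated])
    fix i assume "i \<in> ?S \<times> ?S"
    then obtain C D where "i = (C, D)" "C \<in> ?S" "D \<in> ?S" by blast
    then show "word_lub val (?W i) (?f i)"
      by (simp only: split_conv) (intro word_lub_conc init path fin)
  qed
  moreover have "(\<Union>i\<in>?S \<times> ?S. ?W i)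
      = {w \<in> lang R \<inter> lists (range Inl \<union> Inr ` Y). erase w = u}"
  proof -
    have "(\<Union>i\<in>?S \<times> ?S. ?W i) = {v @ w | v w. v \<in> block_words Y u \<and> w \<in> lists (Inr ` Y) \<and>
        (\<exists>D\<in>?S. \<exists>E\<in>final ?F. nfa_path ?F (initial ?F) v D \<and> nfa_path ?F D w E)}" (is "_ = ?X")
      using initial_follow_automaton(1)[of R] by (fastforce split: if_splits)
    \<comment> \<open>The path for \<open>v\<close> and the path for \<open>w\<close> are glued at
      \<open>D\<close>; the result is an accepting path for \<open>v @ w\<close>.\<close>
    also have "?X = {v @ w | v w. v \<in> block_words Y u \<and> w \<in> lists (Inr ` Y) \<and> v @ w \<in> lang R}"
      using nfa_path_states[OF transitions_follow_automaton initial_follow_automaton(1)[of R]]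
      by (fastforce simp: nfa_path_append simp flip: follow_automaton_accepts_iff)
    also have "\<dots> = {v @ w | v w. v \<in> block_words Y u \<and> w \<in> lists (Inr ` Y)} \<inter> lang R" by blast
    finally show ?thesis by (auto simp: block_words_final)
  qed
  ultimately show "word_lub val {w \<in> lang R \<inter> lists (range Inl \<union> Inr ` Y). erase w = u}
      (automaton_language ?A u)"
    by simp
qed

lemma occurrences_ordinary: "set (occurrences (ordinary c r)) \<subseteq> range Inl \<union> Inr ` c ` scalars r"
  by (induction r) auto

theorem theorem3p1:
  fixes r :: "('a::finite, 'l::integral_lattice_ordered_monoid) fuzzy_regex"
    and Y :: "'y set" and val :: "'y \<Rightarrow> 'l"
  assumes "bij_betw val Y (scalars r)"
  shows "automaton_language (fuzzy_follow_automaton Y val r) = regex_language r"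
proof
  fix u
  let ?R = "ordinary_regex Y val r"
  have image: "val ` Y = scalars r" using assms by (simp add: bij_betw_def)
  \<comment> \<open>An expression contains finitely many scalars; finiteness of \<open>Y\<close>
    makes the sets of minimal words finite.\<close>
  have "finite (scalars r)" by (induction r) auto
  then have "finite Y" using assms by (simp add: bij_betw_finite)
  \<comment> \<open>The letter chosen for each scalar lies in \<open>Y\<close>, so every word of the
    ordinary language uses only \<Sigma> and \<open>Y\<close>.\<close>
  have "inv_into Y val ` scalars r \<subseteq> Y" unfolding image[symmetric] by (auto intro: inv_into_into)
  then have "set (occurrences ?R) \<subseteq> range Inl \<union> Inr ` Y"
    using occurrences_ordinary[of "inv_into Y val" r] unfolding ordinary_regex_def by blast
  then have "lang ?R \<inter> lists (range Inl \<union> Inr ` Y) = lang ?R"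
    using lang_subset_occurrences[of _ ?R] by (fastforce simp: lists_eq_set)
  then have "represents val (lang ?R) (automaton_language (fuzzy_follow_automaton Y val r))"
    using represents_fuzzy_follow_automaton[OF \<open>finite Y\<close>, of val r] by simp
  moreover have "represents val (lang ?R) (regex_language r)"
    unfolding ordinary_regex_def using image by (intro represents_ordinary f_inv_into_f) simp
  ultimately show "automaton_language (fuzzy_follow_automaton Y val r) u = regex_language r u"
    unfolding represents_def by (blast intro: stable_lub_unique)
qed

end
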